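(* Let $n=p_1^{a_1}\cdots p_r^{a_r}>1$ be the prime factorization of $n$, and suppose that all exponents $a_i$ ($i=1,\dots,r$) are odd. Then $n$ is bi-unitary harmonic if and only if $n$ is harmonic.
   Context: $\sigma(n)$ and $d(n)$ denote the sum and the number of positive divisors of $n$; $n$ is harmonic if $\sigma(n)\mid n\,d(n)$. A divisor $d$ of $n$ is a unitary divisor if $\gcd(d,n/d)=1$; a divisor $d$ of $n$ is a bi-unitary divisor if the greatest common unitary divisor of $d$ and $n/d$ is $1$. $\sigma^{**}(n)$ denotes the sum and $d^{**}(n)$ the number of bi-unitary divisors of $n$. $n$ is bi-unitary harmonic if $\sigma^{**}(n)\mid n\,d^{**}(n)$. *)

theory Defs
  imports "HOL-Computational_Algebra.Primes"
begin

(* All notions below are meant for positive arguments. Every number divides 0, so at n = 0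
   sum and card range over infinite sets and return 0. *)

definition divisor_sum :: "nat \<Rightarrow> nat" where
  "divisor_sum n = (\<Sum>d\<in>{d. d dvd n}. d)"

definition divisor_count :: "nat \<Rightarrow> nat" where
  "divisor_count n = card {d. d dvd n}"

definition harmonic :: "nat \<Rightarrow> bool" where
  "harmonic n \<longleftrightarrow> divisor_sum n dvd n * divisor_count n"

definition unitary_divisor :: "nat \<Rightarrow> nat \<Rightarrow> bool" where
  "unitary_divisor d n \<longleftrightarrow> d dvd n \<and> gcd d (n div d) = 1"

(* Greatest common unitary divisor. For positive a and b the set is finite and contains 1. *)
definition gcud :: "nat \<Rightarrow> nat \<Rightarrow> nat" where
  "gcud a b = Max {u. unitary_divisor u a \<and> unitary_divisor u b}"

definition biunitary_divisor :: "nat \<Rightarrow> nat \<Rightarrow> bool" where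
  "biunitary_divisor d n \<longleftrightarrow> d dvd n \<and> gcud d (n div d) = 1"

definition biunitary_divisor_sum :: "nat \<Rightarrow> nat" where
  "biunitary_divisor_sum n = (\<Sum>d\<in>{d. biunitary_divisor d n}. d)"

definition biunitary_divisor_count :: "nat \<Rightarrow> nat" where
  "biunitary_divisor_count n = card {d. biunitary_divisor d n}"

definition biunitary_harmonic :: "nat \<Rightarrow> bool" where
  "biunitary_harmonic n \<longleftrightarrow> biunitary_divisor_sum n dvd n * biunitary_divisor_count n"

end

theory Submission
  imports Defs
begin

text \<open>If \<open>u > 1\<close> were a unitary divisor of both \<open>d\<close> and \<open>n / d\<close>, then any prime
  factor of \<open>u\<close> would occur in \<open>d\<close> and in \<open>n / d\<close> with the same exponent as in \<open>u\<close>,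
  hence in \<open>n\<close> with an even exponent. So if all exponents of \<open>n\<close> are odd, every divisor is
  bi-unitary.\<close>

text \<open>Since \<open>u\<close> is coprime to its cofactor \<open>a div u\<close>, a prime
  \<open>p\<close> dividing \<open>u\<close> cannot divide the cofactor, so \<open>u\<close> carries
  the full power of \<open>p\<close> in \<open>a\<close>.\<close>

lemma multiplicity_unitary_divisor:
  assumes "unitary_divisor u a" "prime p" "p dvd u" "a > 0"
  shows "multiplicity p u = multiplicity p a"
proof -
  have a: "a = u * (a div u)" and "coprime u (a div u)"
    using assms(1) by (auto simp: unitary_divisor_def coprime_iff_gcd_eq_1)
  then have "\<not> p dvd a div u"
    using assms(2,3) by (meson coprime_common_divisor not_prime_unit)
  \<comment> \<open>Positivity of \<open>a\<close> makes both factors nonzero, as additivity of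
    \<open>multiplicity\<close> requires.\<close>
  moreover have "multiplicity p (u * (a div u)) = multiplicity p u + multiplicity p (a div u)"
    using a assms(2,4) by (intro prime_elem_multiplicity_mult_distrib) (auto intro!: Nat.gr0I)
  ultimately show ?thesis
    using a by (simp add: not_dvd_imp_multiplicity_0)
qed

lemma biunitary_divisor_iff_dvd:
  assumes "n > 0" "\<forall>p\<in>prime_factors n. odd (multiplicity p n)"
  shows "biunitary_divisor d n \<longleftrightarrow> d dvd n"
proof
  assume "d dvd n"
  define e where "e = n div d"
  have n: "n = d * e"
    using \<open>d dvd n\<close> by (simp add: e_def)
  then have pos: "d > 0" "e > 0"
    using assms(1) by auto
  have "u = 1" if u: "unitary_divisor u d" "unitary_divisor u e" for u
  proof (rule ccontr)
    assume "u \<noteq> 1"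
    then obtain p where p: "prime p" "p dvd u"
      using prime_factor_nat by blast
    have "multiplicity p n = multiplicity p d + multiplicity p e"
      unfolding n using p(1) pos by (intro prime_elem_multiplicity_mult_distrib) auto
    also have "\<dots> = 2 * multiplicity p u"
      using multiplicity_unitary_divisor[OF u(1) p pos(1)]
        multiplicity_unitary_divisor[OF u(2) p pos(2)] by simp
    finally have "even (multiplicity p n)"
      by simp
    moreover have "p dvd n"
      using u(1) p(2) n by (auto simp: unitary_divisor_def)
    then have "p \<in> prime_factors n"
      using p(1) assms(1) by (simp add: in_prime_factors_iff)
    ultimately show False
      using assms(2) by blast
  qed
  \<comment> \<open>Membership of \<open>1\<close> makes the set a singleton rather than empty, so
    the \<open>Max\<close> in \<open>gcud\<close> is \<open>1\<close>.\<close>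
  moreover have "unitary_divisor 1 d" "unitary_divisor 1 e"
    by (simp_all add: unitary_divisor_def)
  ultimately have "{u. unitary_divisor u d \<and> unitary_divisor u e} = {1}"
    by blast
  with \<open>d dvd n\<close> show "biunitary_divisor d n"
    by (simp add: biunitary_divisor_def gcud_def e_def)
qed (simp add: biunitary_divisor_def)

theorem theorem2:
  fixes n :: nat
  assumes "n > 1"
    and "\<forall>p\<in>prime_factors n. odd (multiplicity p n)"
  shows "biunitary_harmonic n \<longleftrightarrow> harmonic n"
  \<comment> \<open>Bi-unitary divisors and divisors form the same set, so sums and counts agree and
    rewriting makes both divisibility conditions identical.\<close>
  using assms
  by (simp add: biunitary_harmonic_def harmonic_def biunitary_divisor_sum_def divisor_sum_def
      biunitary_divisor_count_def divisor_count_def biunitary_divisor_iff_dvd)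

end
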